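(* For every non-trivial finite group $G$, $$1+\left\lceil\log_2\Delta_{\rm sub}(G)\right\rceil\ \leqslant\ r_{\mathcal D}(\mathcal A_G)\ \leqslant\ 2+\left\lceil\log_2\Delta_{\rm sub}(G)\right\rceil.$$ More precisely, $r_{\mathcal D}(\mathcal A_G)$ is the maximum of $1$ and the values $$2+\left\lceil\log_2 d\bigl(\langle B\rangle,BB^{-1}\bigr)\right\rceil,$$ as $B$ ranges over those sets of the form $$B=F\cup FF^{-1}\cup E,\qquad F\subseteq G,\quad 1\in E=E^{-1}\subseteq G,$$ which are not subgroups of $G$.
   Context: For a finite group $G$, $\mathcal A_G$ is the variety of left $G$-sets with a named constant $c$: its signature has unary operations $\lambda_g$ ($g\in G$) and a constant $c$, with identities $\lambda_1(x)=x$ and $\lambda_g(\lambda_h(x))=\lambda_{gh}(x)$; no identity involving $c$ is imposed. For subsets $X,Y\subseteq G$, $XY=\{xy\mid x\in X,y\in Y\}$ and $X^{-1}=\{x^{-1}\mid x\in X\}$; $S^q$ is the set of products of $q$ elements of $S$, with $S^0=\{1\}$. If $1\in S=S^{-1}\subseteq G$ and $H=\langle S\rangle$, let $d(H,S)=\min\{q\geqslant0\mid S^q=H\}$ (the undirected diameter), and let $$\Delta_{\rm sub}(G)=\max\{d(H,S)\mid H\leqslant G,\ 1\in S=S^{-1},\ \langle S\rangle=H\}.$$ A semicongruence on an algebra $A$ is a reflexive binary relation on $A$ which is a subalgebra of $A\times A$. For $A\in\mathcal A_G$ and $I\subseteq A$, let $R_I$ be the least semicongruence containing $I\times\{c\}$,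 and put $\mathcal D_c(I)=\{x\in A\mid y\,R_I\,x\text{ for some }y\in I\}$. Write $\mathcal D_c^n$ for the $n$-fold iterate (the relation being regenerated from the current set at every step), with $\mathcal D_c^0$ the identity operator. The deductive rank $r_{\mathcal D}(\mathcal A_G)$, taken at $c$, is the least integer $n\ge 0$ such that $\mathcal D_c^n(I)=\mathcal D_c^{n+1}(I)$ for every non-empty subset $I$ of every $A\in\mathcal A_G$ (and $\infty$ if there is none). *)

theory Defs
  imports
    Complex_Main
    "HOL-Library.Extended_Nat"
    "HOL-Algebra.Group_Action"
    "HOL-Algebra.Generated_Groups"
begin

primrec set_power :: "('g, 'm) monoid_scheme \<Rightarrow> 'g set \<Rightarrow> nat \<Rightarrow> 'g set" where
  "set_power G S 0 = {\<one>\<^bsub>G\<^esub>}"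
| "set_power G S (Suc q) = set_power G S q <#>\<^bsub>G\<^esub> S"

(* Meaningful for 1 in S = S^-1 generating a finite subgroup H; only used in that case. *)
definition diam :: "('g, 'm) monoid_scheme \<Rightarrow> 'g set \<Rightarrow> 'g set \<Rightarrow> nat" where
  "diam G H S = (LEAST q. set_power G S q = H)"

definition Delta_sub :: "('g, 'm) monoid_scheme \<Rightarrow> nat" where
  "Delta_sub G = Max {diam G H S | H S.
     subgroup H G \<and> S \<subseteq> carrier G \<and> \<one>\<^bsub>G\<^esub> \<in> S \<and> S = set_inv\<^bsub>G\<^esub> S \<and> generate G S = H}"

(* The members of the variety with carrier A, operations \<phi> g for g in G and constant c.  The
   library's actions are required to be extensional, i.e. each \<phi> g is a fixed dummy value outside A;
   operations on A satisfying the two identities are turned into such an action by restriction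
   (lemma pointed_gset_restrictI), and conversely (lemma pointed_gset_identities). *)
definition pointed_gset ::
  "('g, 'm) monoid_scheme \<Rightarrow> 'a set \<Rightarrow> ('g \<Rightarrow> 'a \<Rightarrow> 'a) \<Rightarrow> 'a \<Rightarrow> bool" where
  "pointed_gset G A \<phi> c \<longleftrightarrow> group_action G A \<phi> \<and> c \<in> A"

lemma pointed_gset_identities:
  assumes "pointed_gset G A \<phi> c"
  shows "c \<in> A"
    and "\<And>g x. g \<in> carrier G \<Longrightarrow> x \<in> A \<Longrightarrow> \<phi> g x \<in> A"
    and "\<And>x. x \<in> A \<Longrightarrow> \<phi> \<one>\<^bsub>G\<^esub> x = x"
    and "\<And>g h x. g \<in> carrier G \<Longrightarrow> h \<in> carrier G \<Longrightarrow> x \<in> A \<Longrightarrow>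
           \<phi> g (\<phi> h x) = \<phi> (g \<otimes>\<^bsub>G\<^esub> h) x"
proof -
  interpret group_action G A \<phi>
    using assms by (simp add: pointed_gset_def)
  show "c \<in> A"
    using assms by (simp add: pointed_gset_def)
  show "\<phi> g x \<in> A" if "g \<in> carrier G" "x \<in> A" for g x
    using element_image that by blast
  show "\<phi> \<one>\<^bsub>G\<^esub> x = x" if "x \<in> A" for x
    using id_eq_one that by (metis restrict_apply')
  show "\<phi> g (\<phi> h x) = \<phi> (g \<otimes>\<^bsub>G\<^esub> h) x"
    if "g \<in> carrier G" "h \<in> carrier G" "x \<in> A" for g h x
    using composition_rule that by simp
qed

lemma pointed_gset_restrictI:
  assumes "group G" "c \<in> A"
    and closed: "\<And>g x. g \<in> carrier G \<Longrightarrow> x \<in> A \<Longrightarrow> l g x \<in> A"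
    and one: "\<And>x. x \<in> A \<Longrightarrow> l \<one>\<^bsub>G\<^esub> x = x"
    and mult: "\<And>g h x. g \<in> carrier G \<Longrightarrow> h \<in> carrier G \<Longrightarrow> x \<in> A \<Longrightarrow>
                 l g (l h x) = l (g \<otimes>\<^bsub>G\<^esub> h) x"
  shows "pointed_gset G A (\<lambda>g. restrict (l g) A) c"
proof -
  interpret group G by fact
  have bij: "bij_betw (l g) A A" if g: "g \<in> carrier G" for g
    by (rule bij_betw_byWitness[where f' = "l (inv\<^bsub>G\<^esub> g)"])
      (use g in \<open>auto simp: closed one mult\<close>)
  have Bij: "restrict (l g) A \<in> Bij A" if "g \<in> carrier G" for g
    using bij[OF that] unfolding Bij_def by (simp add: bij_betw_restrict_eq)
  have "(\<lambda>g. restrict (l g) A) \<in> hom G (BijGroup A)"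
  proof (rule homI)
    show "restrict (l g) A \<in> carrier (BijGroup A)" if "g \<in> carrier G" for g
      using Bij[OF that] by (simp add: BijGroup_def)
    show "restrict (l (g \<otimes>\<^bsub>G\<^esub> h)) A
            = restrict (l g) A \<otimes>\<^bsub>BijGroup A\<^esub> restrict (l h) A"
      if "g \<in> carrier G" "h \<in> carrier G" for g h
      using that Bij by (simp add: BijGroup_def compose_def closed mult restrict_def fun_eq_iff)
  qed
  then show ?thesis
    using assms(1,2) group_BijGroup
    by (simp add: pointed_gset_def group_action_def group_hom_def group_hom_axioms_def)
qed

definition semicongruence ::
  "('g, 'm) monoid_scheme \<Rightarrow> 'a set \<Rightarrow> ('g \<Rightarrow> 'a \<Rightarrow> 'a) \<Rightarrow> 'a \<Rightarrow> 'a rel \<Rightarrow> bool" where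
  "semicongruence G A \<phi> c R \<longleftrightarrow>
     R \<subseteq> A \<times> A \<and> refl_on A R \<and> (c, c) \<in> R \<and>
     (\<forall>g\<in>carrier G. \<forall>(x, y)\<in>R. (\<phi> g x, \<phi> g y) \<in> R)"

definition gen_semicongruence ::
  "('g, 'm) monoid_scheme \<Rightarrow> 'a set \<Rightarrow> ('g \<Rightarrow> 'a \<Rightarrow> 'a) \<Rightarrow> 'a \<Rightarrow> 'a set \<Rightarrow> 'a rel" where
  "gen_semicongruence G A \<phi> c I = \<Inter>{R. semicongruence G A \<phi> c R \<and> I \<times> {c} \<subseteq> R}"

lemma gen_semicongruence_least:
  assumes "pointed_gset G A \<phi> c" "I \<subseteq> A"
  shows "semicongruence G A \<phi> c (gen_semicongruence G A \<phi> c I)"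
    and "I \<times> {c} \<subseteq> gen_semicongruence G A \<phi> c I"
    and "\<And>R. semicongruence G A \<phi> c R \<Longrightarrow> I \<times> {c} \<subseteq> R \<Longrightarrow> gen_semicongruence G A \<phi> c I \<subseteq> R"
proof -
  have full: "semicongruence G A \<phi> c (A \<times> A)" "I \<times> {c} \<subseteq> A \<times> A"
    using pointed_gset_identities[OF assms(1)] assms(2)
    by (auto simp: semicongruence_def refl_on_def)
  have "gen_semicongruence G A \<phi> c I \<subseteq> A \<times> A"
    unfolding gen_semicongruence_def using full by blast
  moreover have "(x, x) \<in> gen_semicongruence G A \<phi> c I" if "x \<in> A" for x
    using that by (simp add: gen_semicongruence_def semicongruence_def refl_on_def)
  moreover have "(c, c) \<in> gen_semicongruence G A \<phi> c I"
    by (simp add: gen_semicongruence_def semicongruence_def)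
  moreover have "(\<phi> g x, \<phi> g y) \<in> gen_semicongruence G A \<phi> c I"
    if "g \<in> carrier G" "(x, y) \<in> gen_semicongruence G A \<phi> c I" for g x y
    using that unfolding gen_semicongruence_def semicongruence_def by blast
  ultimately show "semicongruence G A \<phi> c (gen_semicongruence G A \<phi> c I)"
    unfolding semicongruence_def refl_on_def by blast
qed (auto simp: gen_semicongruence_def)

definition deductive_op ::
  "('g, 'm) monoid_scheme \<Rightarrow> 'a set \<Rightarrow> ('g \<Rightarrow> 'a \<Rightarrow> 'a) \<Rightarrow> 'a \<Rightarrow> 'a set \<Rightarrow> 'a set" where
  "deductive_op G A \<phi> c I = {x \<in> A. \<exists>y\<in>I. (y, x) \<in> gen_semicongruence G A \<phi> c I}"

(* The algebras range over all members of the variety whose carrier is a subset of the type 'a,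
   since HOL cannot quantify over types inside a definition.  The infimum of the empty set of
   extended naturals is infinity. *)
definition deductive_rank :: "('g, 'm) monoid_scheme \<Rightarrow> 'a itself \<Rightarrow> enat" where
  "deductive_rank G (_ :: 'a itself) = Inf {enat n | n.
     \<forall>(A :: 'a set) \<phi> c I. pointed_gset G A \<phi> c \<and> I \<subseteq> A \<and> I \<noteq> {} \<longrightarrow>
       (deductive_op G A \<phi> c ^^ n) I = (deductive_op G A \<phi> c ^^ Suc n) I}"

end

theory Submission
  imports Defs
begin

text \<open>
  The semicongruence \<open>R\<^sub>I\<close> consists of the diagonal and the pairs \<open>(g i, g c)\<close> with \<open>i \<in> I\<close>, so
  \<open>D(I) = I \<union> {g c | g I meets I}\<close> (\<open>deductive_op_eq\<close>).  All new elements thus lie in the orbit of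
  \<open>c\<close>, and the iteration can be followed on the sets \<open>P\<^sub>n = {g | g c \<in> D\<^sup>n(I)}\<close>.

  Suppose first that the orbit of \<open>c\<close> is free.  Let \<open>E\<close> be the symmetric set of those \<open>g\<close> that return
  some element of \<open>I\<close> outside this orbit to \<open>I\<close>.  Then \<open>P\<^sub>n\<^sub>+\<^sub>1 = P\<^sub>n \<union> P\<^sub>n P\<^sub>n\<inverse> \<union> E\<close>.  If \<open>1 \<in> E\<close>, this
  gives \<open>P\<^sub>1 = B := F \<union> F F\<inverse> \<union> E\<close> for \<open>F = P\<^sub>0\<close>; the next step gives \<open>B B\<inverse>\<close>, and each later
  one squares: \<open>P\<^sub>k\<^sub>+\<^sub>2\<close> is the \<open>2\<^sup>k\<close>-th power of \<open>B B\<inverse>\<close> (\<open>quotient_step_iterate\<close>).  The sequence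
  can stop only at a subgroup, which has to be \<open>\<langle>B\<rangle>\<close>; hence it stops by step 1 if \<open>B\<close> is a subgroup,
  and otherwise at the first \<open>k + 2\<close> with \<open>2\<^sup>k \<ge> d(\<langle>B\<rangle>, B B\<inverse>)\<close>
  (\<open>quotient_step_iterate_eq_generate_iff\<close>, \<open>quotient_step_stationary\<close>).

  Every admissible pair \<open>F, E\<close> is realised by such an algebra (\<open>ex_free_pointed_gset\<close>), so the largest
  of these values is a lower bound for the rank.  It is also an upper bound.  For an arbitrary algebra
  with stabiliser \<open>K\<close> of \<open>c\<close>, take for \<open>E\<close> the union of \<open>K\<close> and the set of all \<open>g\<close> such that \<open>g I\<close>
  meets \<open>I\<close>.  The recursion started at \<open>F = P\<^sub>0\<close> then stays below the sets \<open>P\<^sub>n\<close>, while no \<open>D\<^sup>n(I)\<close>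
  leaves \<open>I \<union> \<langle>B\<rangle> c\<close>.  Once the recursion has filled \<open>\<langle>B\<rangle>\<close>, the iterates of \<open>I\<close> are therefore
  stationary (\<open>deductive_op_stable\<close>).

  The comparison with \<open>\<Delta>\<^sub>s\<^sub>u\<^sub>b\<close> is now immediate.  Each \<open>B B\<inverse>\<close> is one of the symmetric generating sets
  over which \<open>\<Delta>\<^sub>s\<^sub>u\<^sub>b\<close> is maximised.  Conversely, a set \<open>S\<close> of maximal diameter at least 2 is itself an admissible
  \<open>B\<close> (with \<open>F = {}\<close> and \<open>E = S\<close>) that is not a subgroup, and \<open>B B\<inverse> = S S\<close> has at least half the diameter of \<open>S\<close>, which
  costs at most 1 in the logarithm.
\<close>

section \<open>Powers of symmetric sets and the diameter\<close>

lemma ceiling_log2_le_iff: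
  assumes "1 \<le> d"
  shows "\<lceil>log 2 (real d)\<rceil> \<le> int k \<longleftrightarrow> d \<le> 2 ^ k"
proof -
  have "\<lceil>log 2 (real d)\<rceil> \<le> int k \<longleftrightarrow> log 2 (real d) \<le> real k"
    by (simp add: ceiling_le_iff)
  also have "\<dots> \<longleftrightarrow> real d \<le> 2 ^ k"
    using assms by (simp add: log_le_iff powr_realpow)
  also have "\<dots> \<longleftrightarrow> d \<le> 2 ^ k"
    by (metis of_nat_le_iff of_nat_numeral of_nat_power)
  finally show ?thesis .
qed

context group
begin

lemma mem_set_mult: "x \<in> X <#> Y \<longleftrightarrow> (\<exists>a\<in>X. \<exists>b\<in>Y. x = a \<otimes> b)"
  by (auto simp: set_mult_def)

lemma mem_set_inv: "x \<in> set_inv X \<longleftrightarrow> (\<exists>a\<in>X. x = inv a)"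
  by (auto simp: SET_INV_def)

lemma mem_set_mult_set_inv: "x \<in> X <#> set_inv Y \<longleftrightarrow> (\<exists>a\<in>X. \<exists>b\<in>Y. x = a \<otimes> inv b)"
  by (auto simp: set_mult_def SET_INV_def)

lemma set_inv_closed: "X \<subseteq> carrier G \<Longrightarrow> set_inv X \<subseteq> carrier G"
  by (auto simp: SET_INV_def)

lemma set_inv_set_mult:
  assumes "X \<subseteq> carrier G" "Y \<subseteq> carrier G"
  shows "set_inv (X <#> Y) = set_inv Y <#> set_inv X"
proof (rule Set.set_eqI)
  fix x
  have "x \<in> set_inv (X <#> Y) \<longleftrightarrow> (\<exists>a\<in>X. \<exists>b\<in>Y. x = inv (a \<otimes> b))"
    by (simp add: SET_INV_def set_mult_def)
  also have "\<dots> \<longleftrightarrow> (\<exists>a\<in>X. \<exists>b\<in>Y. x = inv b \<otimes> inv a)"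
    using assms by (intro bex_cong refl) (simp add: inv_mult_group subset_eq)
  also have "\<dots> \<longleftrightarrow> x \<in> set_inv Y <#> set_inv X"
    by (auto simp: SET_INV_def set_mult_def)
  finally show "x \<in> set_inv (X <#> Y) \<longleftrightarrow> x \<in> set_inv Y <#> set_inv X" .
qed

lemma set_inv_set_inv: "X \<subseteq> carrier G \<Longrightarrow> set_inv (set_inv X) = X"
  by (auto simp: SET_INV_def subset_eq)

lemma set_power_closed: "S \<subseteq> carrier G \<Longrightarrow> set_power G S q \<subseteq> carrier G"
  by (induction q) (simp_all add: set_mult_closed)

lemma one_set_mult: "X \<subseteq> carrier G \<Longrightarrow> {\<one>} <#> X = X"
  and set_mult_one: "X \<subseteq> carrier G \<Longrightarrow> X <#> {\<one>} = X"
  by (force simp: mem_set_mult subset_eq)+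

lemma set_power_add:
  assumes "S \<subseteq> carrier G"
  shows "set_power G S (p + q) = set_power G S p <#> set_power G S q"
  by (induction q)
    (simp_all add: assms set_power_closed set_mult_one set_mult_assoc)

lemma set_power_double:
  assumes "S \<subseteq> carrier G"
  shows "set_power G (S <#> S) q = set_power G S (2 * q)"
proof (induction q)
  case (Suc q)
  have "set_power G S (2 * q) <#> (S <#> S) = set_power G S (2 * Suc q)"
    using assms by (simp add: set_mult_assoc set_power_closed)
  with Suc show ?case by simp
qed simp

lemma subset_set_mult_right: "X \<subseteq> carrier G \<Longrightarrow> \<one> \<in> Y \<Longrightarrow> X \<subseteq> X <#> Y"
  by (force simp: mem_set_mult)

lemma set_power_mono:
  assumes "S \<subseteq> carrier G" "\<one> \<in> S" "p \<le> q"
  shows "set_power G S p \<subseteq> set_power G S q"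
proof (rule lift_Suc_mono_le[OF _ assms(3)])
  show "set_power G S n \<subseteq> set_power G S (Suc n)" for n
    using subset_set_mult_right[OF set_power_closed[OF assms(1)] assms(2)] by simp
qed

lemma set_inv_set_power:
  assumes "S \<subseteq> carrier G" "S = set_inv S"
  shows "set_inv (set_power G S q) = set_power G S q"
proof (induction q)
  case 0
  show ?case by (simp add: SET_INV_def)
next
  case (Suc q)
  have "set_inv (set_power G S (Suc q)) = S <#> set_power G S q"
    using assms(1) Suc by (simp add: set_inv_set_mult set_power_closed assms(2)[symmetric])
  also have "\<dots> = set_power G S (1 + q)"
    using set_power_add[OF assms(1), of 1 q] by (simp add: one_set_mult assms(1))
  finally show ?case by simp
qed

lemma set_mult_subset_subgroup:
  assumes "subgroup H G" "X \<subseteq> H" "Y \<subseteq> H"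
  shows "X <#> Y \<subseteq> H"
  using assms subgroup.m_closed by (fastforce simp: mem_set_mult)

lemma set_inv_subset_subgroup:
  assumes "subgroup H G" "X \<subseteq> H"
  shows "set_inv X \<subseteq> H"
  using assms subgroup.m_inv_closed by (fastforce simp: mem_set_inv)

lemma set_inv_subgroup:
  assumes "subgroup H G"
  shows "set_inv H = H"
proof
  show sub: "set_inv H \<subseteq> H" by (rule set_inv_subset_subgroup[OF assms order_refl])
  have "set_inv (set_inv H) \<subseteq> set_inv H"
    using sub unfolding SET_INV_def by (rule UN_mono) simp
  then show "H \<subseteq> set_inv H"
    by (simp add: set_inv_set_inv subgroup.subset[OF assms])
qed

lemma set_power_subset_subgroup:
  assumes "subgroup H G" "S \<subseteq> H"
  shows "set_power G S q \<subseteq> H"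
  using assms by (induction q) (simp_all add: subgroup.one_closed set_mult_subset_subgroup)

lemma subset_generate: "S \<subseteq> generate G S"
  by (rule subsetI) (rule generate.incl)

lemma set_power_subset_generate: "S \<subseteq> carrier G \<Longrightarrow> set_power G S q \<subseteq> generate G S"
  by (rule set_power_subset_subgroup[OF generate_is_subgroup subset_generate])

text \<open>As \<open>1 \<in> S\<close>, the powers of \<open>S\<close> increase, so a single exponent serves all elements of the finite
group \<open>\<langle>S\<rangle>\<close>.\<close>

lemma ex_set_power_eq_generate:
  assumes S: "S \<subseteq> carrier G" "\<one> \<in> S" "S = set_inv S" and fin: "finite (carrier G)"
  shows "\<exists>q. set_power G S q = generate G S"
proof -
  have "\<exists>q. h \<in> set_power G S q" if "h \<in> generate G S" for h
    using that
  proof (induction rule: generate.induct)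
    case one
    have "\<one> \<in> set_power G S 0" by simp
    then show ?case by blast
  next
    case (incl h)
    then have "h \<in> set_power G S 1" using S(1) by (simp add: one_set_mult)
    then show ?case by blast
  next
    case (inv h)
    then have "inv h \<in> set_inv S" by (auto simp: mem_set_inv)
    then have "inv h \<in> S" by (simp add: S(3)[symmetric])
    then have "inv h \<in> set_power G S 1" using S(1) by (simp add: one_set_mult)
    then show ?case by blast
  next
    case (eng h1 h2)
    then obtain p q where "h1 \<in> set_power G S p" "h2 \<in> set_power G S q" by blast
    then have "h1 \<otimes> h2 \<in> set_power G S (p + q)"
      unfolding set_power_add[OF S(1)] mem_set_mult by blast
    then show ?case by blast
  qed
  then obtain f where f: "\<And>h. h \<in> generate G S \<Longrightarrow> h \<in> set_power G S (f h)" by metis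
  have fin': "finite (generate G S)"
    using finite_subset[OF generate_incl[OF S(1)] fin] .
  define q where "q = Max (f ` generate G S)"
  have "h \<in> set_power G S q" if h: "h \<in> generate G S" for h
  proof -
    have "f h \<le> q" unfolding q_def using fin' h by simp
    then show ?thesis using f[OF h] set_power_mono[OF S(1,2)] by blast
  qed
  moreover have "set_power G S q \<subseteq> generate G S"
    by (rule set_power_subset_generate[OF S(1)])
  ultimately show ?thesis by blast
qed

text \<open>The diameter is defined by an equality of sets; since the powers increase within \<open>\<langle>S\<rangle>\<close>, all larger
exponents satisfy this equality as well.\<close>

lemma set_power_eq_generate_iff:
  assumes S: "S \<subseteq> carrier G" "\<one> \<in> S" "S = set_inv S" and fin: "finite (carrier G)"
  shows "set_power G S q = generate G S \<longleftrightarrow> diam G (generate G S) S \<le> q"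
proof
  show "set_power G S q = generate G S \<Longrightarrow> diam G (generate G S) S \<le> q"
    unfolding diam_def by (rule Least_le)
  assume le: "diam G (generate G S) S \<le> q"
  have "set_power G S (diam G (generate G S) S) = generate G S"
    unfolding diam_def by (rule LeastI_ex[OF ex_set_power_eq_generate[OF assms]])
  moreover have "set_power G S q \<subseteq> generate G S"
    by (rule set_power_subset_generate[OF S(1)])
  ultimately show "set_power G S q = generate G S"
    using set_power_mono[OF S(1,2) le] by blast
qed

section \<open>The recursion on the orbit of the constant\<close>

text \<open>On the group, one step of the deductive operator turns \<open>Q = {g | g c \<in> I}\<close> into this set, if the
orbit of \<open>c\<close> is free and \<open>E\<close> is the set of all \<open>g\<close> that move some element of \<open>I\<close> outside the orbit
to an element of \<open>I\<close>.\<close>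

definition quotient_step :: "'a set \<Rightarrow> 'a set \<Rightarrow> 'a set" where
  "quotient_step E Q = Q \<union> (Q <#> set_inv Q) \<union> E"

lemma quotient_step_mono: "E \<subseteq> E' \<Longrightarrow> Q \<subseteq> Q' \<Longrightarrow> quotient_step E Q \<subseteq> quotient_step E' Q'"
  unfolding quotient_step_def SET_INV_def by (intro Un_mono mono_set_mult UN_mono) auto

lemma quotient_step_closed:
  "E \<subseteq> carrier G \<Longrightarrow> Q \<subseteq> carrier G \<Longrightarrow> quotient_step E Q \<subseteq> carrier G"
  unfolding quotient_step_def using set_mult_closed set_inv_closed by simp

lemma quotient_set_closed: "B \<subseteq> carrier G \<Longrightarrow> B <#> set_inv B \<subseteq> carrier G"
  by (intro set_mult_closed set_inv_closed)

lemma quotient_set_symmetric: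
  assumes "B \<subseteq> carrier G"
  shows "B <#> set_inv B = set_inv (B <#> set_inv B)"
  using assms by (simp add: set_inv_set_mult set_inv_closed set_inv_set_inv)

lemma subset_quotient_set:
  assumes "B \<subseteq> carrier G" "\<one> \<in> B"
  shows "B \<subseteq> B <#> set_inv B"
  using assms by (intro subset_set_mult_right) (force simp: mem_set_inv)+

lemma generate_quotient_set:
  assumes "B \<subseteq> carrier G" "\<one> \<in> B"
  shows "generate G (B <#> set_inv B) = generate G B"
proof
  have sub: "subgroup (generate G B) G" using generate_is_subgroup[OF assms(1)] .
  have "B \<subseteq> generate G B" by (rule subset_generate)
  then have "B <#> set_inv B \<subseteq> generate G B"
    by (intro set_mult_subset_subgroup[OF sub] set_inv_subset_subgroup[OF sub])
  then show "generate G (B <#> set_inv B) \<subseteq> generate G B"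
    by (rule generate_subgroup_incl[OF _ sub])
  show "generate G B \<subseteq> generate G (B <#> set_inv B)"
    by (rule mono_generate[OF subset_quotient_set[OF assms]])
qed

lemma subgroup_if_quotient_closed:
  assumes "Q \<subseteq> carrier G" "\<one> \<in> Q" "Q <#> set_inv Q \<subseteq> Q"
  shows "subgroup Q G"
proof -
  have quot: "a \<otimes> inv b \<in> Q" if "a \<in> Q" "b \<in> Q" for a b
    using assms(3) that by (force simp: mem_set_mult mem_set_inv)
  have inv: "inv b \<in> Q" if "b \<in> Q" for b
    using quot[OF assms(2) that] assms(1) that by (simp add: subset_eq)
  show ?thesis
  proof (rule subgroupI)
    show "a \<otimes> b \<in> Q" if "a \<in> Q" "b \<in> Q" for a b
      using quot[OF that(1) inv[OF that(2)]] assms(1) that by (simp add: subset_eq)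
  qed (use assms inv in auto)
qed

lemma generate_subgroup_eq: "subgroup H G \<Longrightarrow> generate G H = H"
  by (rule equalityI) (simp_all add: subset_generate generate_subgroup_incl)

text \<open>From the first step on, the current set \<open>Q\<close> contains \<open>1\<close> and \<open>E\<close>, so that the step reduces to
\<open>Q \<mapsto> Q Q\<inverse>\<close>; from the second step on \<open>Q\<close> is moreover symmetric, and the step squares it.\<close>

lemma quotient_step_iterate:
  assumes F: "F \<subseteq> carrier G" and E: "E \<subseteq> carrier G" "\<one> \<in> E"
    and B: "B = quotient_step E F"
  shows "(quotient_step E ^^ Suc (Suc k)) F = set_power G (B <#> set_inv B) (2 ^ k)"
proof (induction k)
  have Bc: "B \<subseteq> carrier G" "\<one> \<in> B" "E \<subseteq> B"
    using quotient_step_closed[OF E(1) F] E(2) by (auto simp: B quotient_step_def)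
  note T = quotient_set_closed[OF Bc(1)] subset_quotient_set[OF Bc(1,2)]
    quotient_set_symmetric[OF Bc(1)]
  {
    case 0
    have "quotient_step E B = B <#> set_inv B"
      using T(2) Bc(3) unfolding quotient_step_def by blast
    then show ?case using T(1) by (simp add: B one_set_mult)
  next
    case (Suc k)
    let ?T = "B <#> set_inv B"
    let ?Q = "set_power G ?T (2 ^ k)"
    have one: "\<one> \<in> ?T" using Bc(2) T(2) by blast
    have "?Q <#> set_inv ?Q = set_power G ?T (2 ^ Suc k)"
      using set_power_add[OF T(1), of "2 ^ k" "2 ^ k"]
      by (simp add: set_inv_set_power[OF T(1,3)] mult_2)
    moreover have "?Q \<subseteq> set_power G ?T (2 ^ Suc k)"
      by (rule set_power_mono[OF T(1) one]) simp
    moreover have "E \<subseteq> set_power G ?T (2 ^ Suc k)"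
      using set_power_mono[OF T(1) one, of 1 "2 ^ Suc k"] T(1,2) Bc(3)
      by (simp add: one_set_mult)
    ultimately have "quotient_step E ?Q = set_power G ?T (2 ^ Suc k)"
      unfolding quotient_step_def by blast
    with Suc show ?case by simp
  }
qed

lemma set_power_quotient_set_iff:
  assumes B: "B \<subseteq> carrier G" "\<one> \<in> B" and fin: "finite (carrier G)"
  shows "set_power G (B <#> set_inv B) q = generate G B \<longleftrightarrow>
    diam G (generate G B) (B <#> set_inv B) \<le> q"
proof -
  have "\<one> \<in> B <#> set_inv B" using B(2) subset_quotient_set[OF B] by blast
  from set_power_eq_generate_iff[OF quotient_set_closed[OF B(1)] this
      quotient_set_symmetric[OF B(1)] fin]
  show ?thesis by (simp add: generate_quotient_set[OF B])
qed

text \<open>Positivity keeps the logarithm of this diameter out of the case \<open>log 2 0\<close>, where it carries no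
information.\<close>

lemma diam_quotient_set_pos:
  assumes B: "B \<subseteq> carrier G" "\<one> \<in> B" and fin: "finite (carrier G)" and "\<not> subgroup B G"
  shows "1 \<le> diam G (generate G B) (B <#> set_inv B)"
proof (rule ccontr)
  assume "\<not> ?thesis"
  then have "generate G B = {\<one>}" using set_power_quotient_set_iff[OF B fin, of 0] by simp
  then have "B = {\<one>}" using B(2) subset_generate[of B] by blast
  then show False using assms(4) triv_subgroup by simp
qed

text \<open>If \<open>B\<close> is a subgroup, the recursion has reached \<open>\<langle>B\<rangle> = B\<close> after one step.  Otherwise it needs the
first power of two that is at least the diameter of \<open>B B\<inverse>\<close>, and two further steps for passing from
\<open>F\<close> to \<open>B\<close> and from \<open>B\<close> to \<open>B B\<inverse>\<close>.\<close>

lemma quotient_step_iterate_eq_generate_iff: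
  assumes F: "F \<subseteq> carrier G" and E: "E \<subseteq> carrier G" "\<one> \<in> E"
    and fin: "finite (carrier G)" and B: "B = quotient_step E F" and n: "1 \<le> n"
  shows "(quotient_step E ^^ n) F = generate G B \<longleftrightarrow>
    (subgroup B G \<or> 2 + \<lceil>log 2 (real (diam G (generate G B) (B <#> set_inv B)))\<rceil> \<le> int n)"
proof -
  let ?T = "B <#> set_inv B" and ?H = "generate G B"
  let ?d = "diam G ?H ?T"
  have Bc: "B \<subseteq> carrier G" "\<one> \<in> B" and "E \<subseteq> B"
    using quotient_step_closed[OF E(1) F] E(2) by (auto simp: B quotient_step_def)
  have sub: "subgroup ?H G" using generate_is_subgroup[OF Bc(1)] .
  note T = subset_quotient_set[OF Bc]
  note iff = set_power_quotient_set_iff[OF Bc fin]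
  have d: "1 \<le> ?d" if "\<not> subgroup B G"
    by (rule diam_quotient_set_pos[OF Bc fin that])
  show ?thesis
  proof (cases "subgroup B G")
    case True
    have eq: "?H = B" using generate_subgroup_eq[OF True] .
    have "?T = B"
      using T set_mult_subset_subgroup[OF True order_refl set_inv_subset_subgroup[OF True order_refl]]
      by blast
    then have "quotient_step E B = B"
      unfolding quotient_step_def using \<open>E \<subseteq> B\<close> by blast
    then have iter: "(quotient_step E ^^ k) B = B" for k
      by (induction k) simp_all
    obtain k where k: "n = Suc k" using n by (cases n) auto
    have "(quotient_step E ^^ n) F = (quotient_step E ^^ k) B"
      unfolding k B by (simp only: funpow_Suc_right o_apply)
    with True eq iter show ?thesis by simp
  next
    case nsub: False
    consider "n = 1" | k where "n = Suc (Suc k)"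
      using n by (cases n; cases "n - 1") auto
    then show ?thesis
    proof cases
      case 1
      have "B \<noteq> ?H" using sub nsub by metis
      moreover have "0 \<le> log 2 (real ?d)" using d[OF nsub] by simp
      then have "\<not> 2 + \<lceil>log 2 (real ?d)\<rceil> \<le> 1"
        by linarith
      ultimately show ?thesis using nsub 1 by (simp add: B)
    next
      case 2
      have "(quotient_step E ^^ n) F = ?H \<longleftrightarrow> ?d \<le> 2 ^ k"
        unfolding 2 quotient_step_iterate[OF F E B] by (rule iff)
      also have "\<dots> \<longleftrightarrow> \<lceil>log 2 (real ?d)\<rceil> \<le> int k"
        using ceiling_log2_le_iff[OF d[OF nsub]] by simp
      finally show ?thesis using nsub 2 by simp
    qed
  qed
qed

lemma quotient_step_iterate_subset_generate:
  assumes F: "F \<subseteq> carrier G" and E: "E \<subseteq> carrier G"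
  shows "(quotient_step E ^^ n) F \<subseteq> generate G (quotient_step E F)"
proof (induction n)
  let ?H = "generate G (quotient_step E F)"
  have sub: "subgroup ?H G"
    using generate_is_subgroup[OF quotient_step_closed[OF E F]] .
  have BH: "quotient_step E F \<subseteq> ?H" by (rule subset_generate)
  {
    case 0
    show ?case using BH by (simp add: quotient_step_def)
  next
    case (Suc n)
    let ?Q = "(quotient_step E ^^ n) F"
    have "?Q <#> set_inv ?Q \<subseteq> ?H"
      using set_mult_subset_subgroup[OF sub Suc set_inv_subset_subgroup[OF sub Suc]] .
    moreover have "E \<subseteq> ?H" using BH unfolding quotient_step_def[of E F] by blast
    ultimately have "quotient_step E ?Q \<subseteq> ?H"
      unfolding quotient_step_def[of E ?Q] using Suc by (intro Un_least)
    then show ?case by simp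
  }
qed

text \<open>A fixed point \<open>Q\<close> of the step satisfies \<open>Q Q\<inverse> \<subseteq> Q\<close> and contains \<open>E \<ni> 1\<close>, hence is a subgroup.
Being an iterate, it lies between \<open>B\<close> and \<open>\<langle>B\<rangle>\<close>, where \<open>B\<close> is the set reached after one step.\<close>

lemma quotient_step_stationary:
  assumes F: "F \<subseteq> carrier G" and E: "E \<subseteq> carrier G" "\<one> \<in> E"
    and stat: "(quotient_step E ^^ n) F = (quotient_step E ^^ Suc n) F"
  shows "(quotient_step E ^^ n) F = generate G (quotient_step E F)"
proof
  let ?Q = "(quotient_step E ^^ n) F"
  show QH: "?Q \<subseteq> generate G (quotient_step E F)"
    by (rule quotient_step_iterate_subset_generate[OF F E(1)])
  have fixed: "quotient_step E ?Q \<subseteq> ?Q"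
    using stat unfolding funpow.simps o_apply by (rule equalityD2)
  have "?Q \<subseteq> carrier G"
    using QH generate_incl[OF quotient_step_closed[OF E(1) F]] by blast
  then have sub: "subgroup ?Q G"
    using fixed E(2) by (intro subgroup_if_quotient_closed) (auto simp: quotient_step_def)
  have "F \<subseteq> (quotient_step E ^^ m) F" for m
    by (induction m) (auto simp: quotient_step_def)
  then have "quotient_step E F \<subseteq> ?Q"
    using quotient_step_mono[OF order_refl, of F ?Q E] fixed by blast
  then show "generate G (quotient_step E F) \<subseteq> ?Q"
    by (rule generate_subgroup_incl[OF _ sub])
qed


section \<open>The deductive operator on pointed G-sets\<close>

definition returners :: "('a \<Rightarrow> 'x \<Rightarrow> 'x) \<Rightarrow> 'x set \<Rightarrow> 'a set" where
  "returners \<phi> I = {g \<in> carrier G. \<exists>x\<in>I. \<phi> g x \<in> I}"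

lemma gset_inverse:
  assumes "pointed_gset G A \<phi> c" "g \<in> carrier G" "x \<in> A"
  shows "\<phi> (inv g) (\<phi> g x) = x"
  using pointed_gset_identities[OF assms(1)] assms(2,3) by simp

lemma set_inv_returners:
  assumes "pointed_gset G A \<phi> c" "I \<subseteq> A"
  shows "set_inv (returners \<phi> I) = returners \<phi> I"
proof -
  have sub: "inv g \<in> returners \<phi> I" if g: "g \<in> returners \<phi> I" for g
  proof -
    obtain x where "g \<in> carrier G" "x \<in> I" "\<phi> g x \<in> I"
      using g by (auto simp: returners_def)
    moreover from this have "\<phi> (inv g) (\<phi> g x) = x"
      using gset_inverse[OF assms(1)] assms(2) by blast
    ultimately show ?thesis unfolding returners_def by force
  qed
  have carr: "g \<in> carrier G" if "g \<in> returners \<phi> I" for g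
    using that by (simp add: returners_def)
  have "g \<in> set_inv (returners \<phi> I)" if g: "g \<in> returners \<phi> I" for g
    unfolding mem_set_inv using sub[OF g] carr[OF g] inv_inv by metis
  then show ?thesis using sub by (auto simp: mem_set_inv)
qed

text \<open>Unary operations cannot combine two pairs, so the subalgebra generated by the diagonal and
\<open>I \<times> {c}\<close> is the union of their translates.\<close>

lemma gen_semicongruence_eq:
  assumes pg: "pointed_gset G A \<phi> c" and I: "I \<subseteq> A"
  shows "gen_semicongruence G A \<phi> c I =
    Id_on A \<union> {(\<phi> g i, \<phi> g c) | g i. g \<in> carrier G \<and> i \<in> I}"
proof -
  note ids = pointed_gset_identities[OF pg]
  note least = gen_semicongruence_least[OF assms]
  define R where "R = Id_on A \<union> {(\<phi> g i, \<phi> g c) | g i. g \<in> carrier G \<and> i \<in> I}"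
  have cases: "(x \<in> A \<and> y = x) \<or> (\<exists>h i. h \<in> carrier G \<and> i \<in> I \<and> x = \<phi> h i \<and> y = \<phi> h c)"
    if "(x, y) \<in> R" for x y
    using that unfolding R_def by blast
  have diag: "(x, x) \<in> R" if "x \<in> A" for x
    using that unfolding R_def by blast
  have pair: "(\<phi> g i, \<phi> g c) \<in> R" if "g \<in> carrier G" "i \<in> I" for g i
    using that unfolding R_def by blast
  have step: "(\<phi> g x, \<phi> g y) \<in> R" if g: "g \<in> carrier G" and xy: "(x, y) \<in> R" for g x y
    using cases[OF xy]
  proof (elim disjE exE conjE)
    show "(\<phi> g x, \<phi> g y) \<in> R" if "x \<in> A" "y = x"
      using that diag ids(2)[OF g] by simp
    show "(\<phi> g x, \<phi> g y) \<in> R"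
      if "h \<in> carrier G" "i \<in> I" "x = \<phi> h i" "y = \<phi> h c" for h i
    proof -
      have "\<phi> g x = \<phi> (g \<otimes> h) i" "\<phi> g y = \<phi> (g \<otimes> h) c"
        using that g I ids(1) ids(4)[OF g] by auto
      then show ?thesis using pair[of "g \<otimes> h" i] that g by simp
    qed
  qed
  have "R \<subseteq> A \<times> A" using ids(1,2) I unfolding R_def by auto
  then have "semicongruence G A \<phi> c R"
    using ids(1) step diag by (auto simp: semicongruence_def refl_on_def)
  moreover have "(i, c) \<in> R" if "i \<in> I" for i
    using pair[OF one_closed that] ids(1,3) I that by auto
  ultimately have "gen_semicongruence G A \<phi> c I \<subseteq> R"
    by (intro least(3)) auto
  moreover have "R \<subseteq> gen_semicongruence G A \<phi> c I"
    using least(1,2) unfolding R_def semicongruence_def refl_on_def by blast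
  ultimately show ?thesis unfolding R_def by (rule equalityI)
qed

lemma deductive_op_eq:
  assumes "pointed_gset G A \<phi> c" "I \<subseteq> A"
  shows "deductive_op G A \<phi> c I = I \<union> (\<lambda>g. \<phi> g c) ` returners \<phi> I"
proof (intro equalityI subsetI)
  fix x
  show "x \<in> I \<union> (\<lambda>g. \<phi> g c) ` returners \<phi> I" if "x \<in> deductive_op G A \<phi> c I"
    using that unfolding deductive_op_def gen_semicongruence_eq[OF assms] returners_def by auto
  assume "x \<in> I \<union> (\<lambda>g. \<phi> g c) ` returners \<phi> I"
  then show "x \<in> deductive_op G A \<phi> c I"
  proof
    assume "x \<in> I"
    then show ?thesis
      using assms(2) unfolding deductive_op_def gen_semicongruence_eq[OF assms]
      by (auto intro!: bexI[of _ x])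
  next
    assume "x \<in> (\<lambda>g. \<phi> g c) ` returners \<phi> I"
    then obtain g i where "x = \<phi> g c" "g \<in> carrier G" "i \<in> I" "\<phi> g i \<in> I"
      unfolding returners_def by blast
    then show ?thesis
      using pointed_gset_identities(1,2)[OF assms(1)]
      unfolding deductive_op_def gen_semicongruence_eq[OF assms] by blast
  qed
qed

lemma deductive_op_mono:
  assumes "pointed_gset G A \<phi> c" "J \<subseteq> A" "I \<subseteq> J"
  shows "deductive_op G A \<phi> c I \<subseteq> deductive_op G A \<phi> c J"
proof -
  have "returners \<phi> I \<subseteq> returners \<phi> J"
    using assms(3) unfolding returners_def by blast
  then show ?thesis
    unfolding deductive_op_eq[OF assms(1,2)] deductive_op_eq[OF assms(1) subset_trans[OF assms(3,2)]]
    using assms(3) by blast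
qed

lemma deductive_op_iterate_bounds:
  assumes "pointed_gset G A \<phi> c" "I \<subseteq> A"
  shows "(deductive_op G A \<phi> c ^^ n) I \<subseteq> A" "I \<subseteq> (deductive_op G A \<phi> c ^^ n) I"
proof (induction n)
  case (Suc n)
  { case 1 then show ?case by (auto simp: deductive_op_def)
  next case 2 then show ?case using Suc by (simp add: deductive_op_eq[OF assms(1)]) blast }
qed (use assms in auto)

subsection \<open>The upper bound\<close>

text \<open>Both kinds of elements of \<open>E\<close> enter at the first step: if \<open>g I\<close> meets \<open>I\<close>, then \<open>g c\<close> is deduced, and
\<open>g c = c\<close> is deduced for \<open>g\<close> in the stabiliser because \<open>I\<close> is non-empty.  Quotients enter because
\<open>a b\<inverse>\<close> moves \<open>b c\<close> to \<open>a c\<close>.\<close>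

lemma deductive_op_iterate_lower:
  assumes pg: "pointed_gset G A \<phi> c" and I: "I \<subseteq> A" "I \<noteq> {}"
  shows "(quotient_step (returners \<phi> I \<union> stabilizer G \<phi> c) ^^ n)
      {g \<in> carrier G. \<phi> g c \<in> I}
    \<subseteq> {g \<in> carrier G. \<phi> g c \<in> (deductive_op G A \<phi> c ^^ n) I}"
proof (induction n)
  case (Suc n)
  note ids = pointed_gset_identities[OF pg]
  let ?E = "returners \<phi> I \<union> stabilizer G \<phi> c"
  let ?Q = "(quotient_step ?E ^^ n) {g \<in> carrier G. \<phi> g c \<in> I}"
  let ?J = "(deductive_op G A \<phi> c ^^ n) I"
  have J: "?J \<subseteq> A" "I \<subseteq> ?J"
    using deductive_op_iterate_bounds[OF pg I(1)] by blast+
  have D: "(deductive_op G A \<phi> c ^^ Suc n) I = ?J \<union> (\<lambda>g. \<phi> g c) ` returners \<phi> ?J"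
    using deductive_op_eq[OF pg J(1)] by simp
  obtain i where i: "i \<in> I" using I(2) by blast
  then have "\<phi> \<one> i = i" using ids(3) I(1) by blast
  then have "\<one> \<in> returners \<phi> ?J"
    using i J(2) unfolding returners_def by force
  then have c: "c \<in> (\<lambda>g. \<phi> g c) ` returners \<phi> ?J"
    using ids(1,3) by force
  have "g \<in> returners \<phi> ?J" if quot: "g \<in> ?Q <#> set_inv ?Q" for g
  proof -
    obtain a b where g: "g = a \<otimes> inv b" and "a \<in> ?Q" "b \<in> ?Q"
      using quot unfolding mem_set_mult_set_inv by blast
    then have ab: "a \<in> carrier G" "b \<in> carrier G" "\<phi> a c \<in> ?J" "\<phi> b c \<in> ?J"
      using Suc by auto
    have "\<phi> (inv b) (\<phi> b c) = c" using gset_inverse[OF pg ab(2) ids(1)] .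
    then have "\<phi> g (\<phi> b c) = \<phi> a c"
      unfolding g using ab(1,2) ids(1,2) by (metis ids(4) inv_closed)
    then show ?thesis using ab g unfolding returners_def by force
  qed
  moreover have "returners \<phi> I \<subseteq> returners \<phi> ?J"
    using J(2) unfolding returners_def by blast
  moreover have "returners \<phi> ?J \<subseteq> {g \<in> carrier G. \<phi> g c \<in> (deductive_op G A \<phi> c ^^ Suc n) I}"
    unfolding D returners_def by blast
  moreover have "stabilizer G \<phi> c \<subseteq> {g \<in> carrier G. \<phi> g c \<in> (deductive_op G A \<phi> c ^^ Suc n) I}"
    using c unfolding D stabilizer_def by auto
  moreover have "?Q \<subseteq> {g \<in> carrier G. \<phi> g c \<in> (deductive_op G A \<phi> c ^^ Suc n) I}"
    using Suc unfolding D by blast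
  ultimately have "quotient_step ?E ?Q
      \<subseteq> {g \<in> carrier G. \<phi> g c \<in> (deductive_op G A \<phi> c ^^ Suc n) I}"
    unfolding quotient_step_def[of ?E ?Q] by blast
  then show ?case by simp
qed simp

text \<open>The set \<open>T = I \<union> H c\<close> is closed under deduction: as \<open>H\<close> contains the stabiliser and all \<open>u\<close> with
\<open>u c \<in> I\<close>, it contains every \<open>u\<close> with \<open>u c \<in> T\<close>, and therefore every \<open>g\<close> that moves one element of \<open>T\<close>
to another.\<close>

lemma deductive_op_iterate_upper:
  assumes pg: "pointed_gset G A \<phi> c" and I: "I \<subseteq> A"
    and H: "subgroup H G" "returners \<phi> I \<subseteq> H" "stabilizer G \<phi> c \<subseteq> H"
      "{g \<in> carrier G. \<phi> g c \<in> I} \<subseteq> H"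
  shows "(deductive_op G A \<phi> c ^^ n) I \<subseteq> I \<union> (\<lambda>g. \<phi> g c) ` H"
proof (induction n)
  case (Suc n)
  note ids = pointed_gset_identities[OF pg]
  let ?T = "I \<union> (\<lambda>g. \<phi> g c) ` H"
  have Hc: "\<And>h. h \<in> H \<Longrightarrow> h \<in> carrier G" using subgroup.mem_carrier[OF H(1)] .
  have T: "?T \<subseteq> A" using I ids(1,2) Hc by blast
  have orbit: "u \<in> H" if u: "u \<in> carrier G" "\<phi> u c \<in> ?T" for u
  proof (cases "\<phi> u c \<in> I")
    case True
    then show ?thesis using u H(4) by blast
  next
    case False
    then obtain h where h: "h \<in> H" "\<phi> u c = \<phi> h c" using u by blast
    have "\<phi> (inv h \<otimes> u) c = \<phi> (inv h) (\<phi> h c)"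
      using h u Hc ids(1,4) by (metis inv_closed)
    also have "\<dots> = c" using gset_inverse[OF pg Hc[OF h(1)] ids(1)] .
    finally have "inv h \<otimes> u \<in> H"
      using H(3) u h Hc unfolding stabilizer_def by auto
    then have "h \<otimes> (inv h \<otimes> u) \<in> H" using h(1) subgroup.m_closed[OF H(1)] by blast
    then show ?thesis using h u Hc by (simp add: m_assoc[symmetric])
  qed
  have "g \<in> H" if ret: "g \<in> returners \<phi> ?T" for g
  proof -
    obtain x where g: "g \<in> carrier G" and x: "x \<in> ?T" "\<phi> g x \<in> ?T"
      using ret unfolding returners_def by blast
    consider "x \<in> I" "\<phi> g x \<in> I" | h where "h \<in> H" "x \<in> A" "\<phi> g x = \<phi> h c"
      | h where "h \<in> H" "x = \<phi> h c"
      using x T by blast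
    then show ?thesis
    proof cases
      case 1
      then show ?thesis using g H(2) unfolding returners_def by blast
    next
      case (2 h)
      have "\<phi> (inv g \<otimes> h) c = \<phi> (inv g) (\<phi> g x)"
        using 2 g Hc ids(1,4) by (metis inv_closed)
      also have "\<dots> = x" using gset_inverse[OF pg g 2(2)] .
      finally have "inv g \<otimes> h \<in> H" using orbit x g 2 Hc by simp
      then have "h \<otimes> inv (inv g \<otimes> h) \<in> H"
        using 2(1) subgroup.m_closed[OF H(1)] subgroup.m_inv_closed[OF H(1)] by blast
      then show ?thesis
        using g Hc[OF 2(1)] by (simp add: inv_mult_group m_assoc[symmetric])
    next
      case (3 h)
      have "\<phi> (g \<otimes> h) c \<in> ?T" using 3 x(2) g Hc ids(1,4) by metis
      then have "g \<otimes> h \<in> H" using orbit g Hc[OF 3(1)] by simp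
      then have "(g \<otimes> h) \<otimes> inv h \<in> H"
        using 3(1) subgroup.m_closed[OF H(1)] subgroup.m_inv_closed[OF H(1)] by blast
      then show ?thesis using g Hc[OF 3(1)] by (simp add: m_assoc)
    qed
  qed
  then have "deductive_op G A \<phi> c ?T \<subseteq> ?T"
    unfolding deductive_op_eq[OF pg T] by blast
  then show ?case using deductive_op_mono[OF pg T Suc] by simp
qed simp

text \<open>If the recursion has filled \<open>H = \<langle>B\<rangle>\<close>, the lower and the upper estimate meet at \<open>I \<union> H c\<close>.  Adding the
stabiliser to \<open>E\<close> is what makes this work when the orbit of \<open>c\<close> is not free.\<close>

lemma deductive_op_stable:
  assumes pg: "pointed_gset G A \<phi> c" and I: "I \<subseteq> A" "I \<noteq> {}" and fin: "finite (carrier G)"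
    and n: "1 \<le> n"
    and bound: "\<And>F E. F \<subseteq> carrier G \<Longrightarrow> E \<subseteq> carrier G \<Longrightarrow> \<one> \<in> E \<Longrightarrow> E = set_inv E \<Longrightarrow>
      (quotient_step E ^^ n) F = generate G (quotient_step E F)"
  shows "(deductive_op G A \<phi> c ^^ n) I = (deductive_op G A \<phi> c ^^ Suc n) I"
proof -
  note ids = pointed_gset_identities[OF pg]
  let ?K = "stabilizer G \<phi> c"
  define E where "E = returners \<phi> I \<union> ?K"
  define F where "F = {g \<in> carrier G. \<phi> g c \<in> I}"
  define H where "H = generate G (quotient_step E F)"
  have F: "F \<subseteq> carrier G" and E: "E \<subseteq> carrier G"
    unfolding E_def F_def returners_def stabilizer_def by auto
  have one: "\<one> \<in> E" using ids(1,3) unfolding E_def stabilizer_def by simp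
  have "subgroup ?K G"
    using pg group_action.stabilizer_subgroup ids(1) unfolding pointed_gset_def by metis
  then have K: "set_inv ?K = ?K"
    by (rule set_inv_subgroup)
  have "set_inv E = E"
    using set_inv_returners[OF pg I(1)] K unfolding E_def SET_INV_def by auto
  then have H: "(quotient_step E ^^ n) F = H"
    unfolding H_def using bound[OF F E one] by simp
  have sub: "subgroup H G"
    unfolding H_def by (rule generate_is_subgroup[OF quotient_step_closed[OF E F]])
  have "E \<subseteq> H" "F \<subseteq> H"
    using subset_generate[of "quotient_step E F"] unfolding H_def quotient_step_def by auto
  then have upper: "(deductive_op G A \<phi> c ^^ m) I \<subseteq> I \<union> (\<lambda>g. \<phi> g c) ` H" for m
    using deductive_op_iterate_upper[OF pg I(1) sub] unfolding E_def F_def by simp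
  have "I \<union> (\<lambda>g. \<phi> g c) ` H \<subseteq> (deductive_op G A \<phi> c ^^ n) I"
    using deductive_op_iterate_lower[OF pg I, of n] deductive_op_iterate_bounds[OF pg I(1), of n] H
    unfolding E_def F_def by auto
  moreover have "(deductive_op G A \<phi> c ^^ n) I \<subseteq> (deductive_op G A \<phi> c ^^ Suc n) I"
    using deductive_op_eq[OF pg deductive_op_iterate_bounds(1)[OF pg I(1), of n]] by simp
  ultimately show ?thesis using upper[of "Suc n"] by blast
qed

subsection \<open>The lower bound\<close>

text \<open>With \<open>c\<close> in a free orbit disjoint from \<open>I\<close>, an element of the group that returns a point of \<open>I \<union> Q c\<close> to
this set does so within \<open>I\<close> or within \<open>Q c\<close>; the latter happens exactly for \<open>Q Q\<inverse>\<close>.\<close>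

lemma deductive_op_free_orbit:
  assumes pg: "pointed_gset G A \<phi> c" and I: "I \<subseteq> A" and Q: "Q \<subseteq> carrier G"
    and free: "inj_on (\<lambda>g. \<phi> g c) (carrier G)"
    and disj: "\<And>g. g \<in> carrier G \<Longrightarrow> \<phi> g c \<notin> I"
  shows "deductive_op G A \<phi> c (I \<union> (\<lambda>g. \<phi> g c) ` Q) =
    I \<union> (\<lambda>g. \<phi> g c) ` quotient_step (returners \<phi> I) Q"
proof -
  note ids = pointed_gset_identities[OF pg]
  let ?J = "I \<union> (\<lambda>g. \<phi> g c) ` Q"
  have J: "?J \<subseteq> A" using I Q ids(1,2) by blast
  have "g \<in> returners \<phi> I \<union> (Q <#> set_inv Q)" if ret: "g \<in> returners \<phi> ?J" for g
  proof -
    obtain x where g: "g \<in> carrier G" and x: "x \<in> ?J" "\<phi> g x \<in> ?J"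
      using ret unfolding returners_def by blast
    show ?thesis
    proof (cases "x \<in> I")
      case True
      have "\<phi> g x \<noteq> \<phi> q c" if "q \<in> Q" for q
      proof
        assume "\<phi> g x = \<phi> q c"
        then have "\<phi> (inv g \<otimes> q) c = \<phi> (inv g) (\<phi> g x)"
          using that Q g ids(1,4) by (metis inv_closed subsetD)
        also have "\<dots> = x" using gset_inverse[OF pg g] True I by blast
        finally show False using disj[of "inv g \<otimes> q"] True g that Q by auto
      qed
      then have "\<phi> g x \<in> I" using x by blast
      then show ?thesis using True g unfolding returners_def by blast
    next
      case False
      then obtain q where q: "q \<in> Q" "x = \<phi> q c" using x by blast
      then have gq: "\<phi> g x = \<phi> (g \<otimes> q) c" "g \<otimes> q \<in> carrier G"
        using Q g ids(1,4) by auto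
      then obtain p where p: "p \<in> Q" "\<phi> (g \<otimes> q) c = \<phi> p c"
        using x disj by force
      then have "g \<otimes> q = p" using inj_onD[OF free] gq Q by blast
      then have "g = p \<otimes> inv q" using g q Q by (auto simp: m_assoc)
      then show ?thesis using p(1) q(1) unfolding Un_iff mem_set_mult_set_inv by blast
    qed
  qed
  moreover have "g \<in> returners \<phi> ?J" if quot: "g \<in> Q <#> set_inv Q" for g
  proof -
    obtain p q where g: "g = p \<otimes> inv q" and pq: "p \<in> Q" "q \<in> Q"
      using quot unfolding mem_set_mult_set_inv by blast
    then have carr: "p \<in> carrier G" "q \<in> carrier G" using Q by auto
    have "\<phi> g (\<phi> q c) = \<phi> (p \<otimes> inv q \<otimes> q) c"
      unfolding g using carr ids(1,4) by simp
    then have "\<phi> g (\<phi> q c) = \<phi> p c" using carr by (simp add: m_assoc)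
    then show ?thesis using g pq carr unfolding returners_def by force
  qed
  moreover have "returners \<phi> I \<subseteq> returners \<phi> ?J" unfolding returners_def by blast
  ultimately have "returners \<phi> ?J = returners \<phi> I \<union> (Q <#> set_inv Q)" by blast
  then show ?thesis unfolding deductive_op_eq[OF pg J] quotient_step_def by blast
qed

lemma deductive_op_iterate_free_orbit:
  assumes pg: "pointed_gset G A \<phi> c" and I: "I \<subseteq> A" and Q: "Q \<subseteq> carrier G"
    and free: "inj_on (\<lambda>g. \<phi> g c) (carrier G)"
    and disj: "\<And>g. g \<in> carrier G \<Longrightarrow> \<phi> g c \<notin> I"
  shows "(deductive_op G A \<phi> c ^^ n) (I \<union> (\<lambda>g. \<phi> g c) ` Q) =
    I \<union> (\<lambda>g. \<phi> g c) ` (quotient_step (returners \<phi> I) ^^ n) Q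
    \<and> (quotient_step (returners \<phi> I) ^^ n) Q \<subseteq> carrier G"
proof (induction n)
  case (Suc n)
  have "returners \<phi> I \<subseteq> carrier G" unfolding returners_def by blast
  with Suc show ?case
    by (simp add: deductive_op_free_orbit[OF pg I _ free disj] quotient_step_closed)
qed (use Q in simp)

text \<open>Take one copy of the regular \<open>G\<close>-set for \<open>c\<close> and one for each \<open>e \<in> E\<close>, and let \<open>I\<close> meet the copy
indexed by \<open>e\<close> in \<open>{1, e}\<close>.  In that copy exactly \<open>1\<close>, \<open>e\<close> and \<open>e\<inverse>\<close> return a point of \<open>I\<close> to \<open>I\<close>.
This finite algebra is transported into the given infinite type along an injection \<open>f\<close>.\<close>

lemma ex_free_pointed_gset:
  assumes fin: "finite (carrier G)" and inf: "infinite (UNIV :: 'x set)"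
    and E: "E \<subseteq> carrier G" "\<one> \<in> E" "E = set_inv E"
  obtains A :: "'x set" and \<phi> c I where "pointed_gset G A \<phi> c" "I \<subseteq> A"
    "inj_on (\<lambda>g. \<phi> g c) (carrier G)" "\<And>g. g \<in> carrier G \<Longrightarrow> \<phi> g c \<notin> I" "returners \<phi> I = E"
proof -
  define X where "X = carrier G \<times> insert None (Some ` E)"
  have "finite X" unfolding X_def using fin finite_subset[OF E(1) fin] by simp
  moreover obtain Y :: "'x set" where "finite Y" "card Y = card X"
    using infinite_arbitrarily_large[OF inf] by blast
  ultimately obtain f where "bij_betw f X Y"
    using finite_same_card_bij by metis
  then have f: "inj_on f X" by (rule bij_betw_imp_inj_on)
  define A where "A = f ` X"
  define l where "l g a = (case inv_into X f a of (h, s) \<Rightarrow> f (g \<otimes> h, s))" for g a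
  define \<phi> where "\<phi> g = restrict (l g) A" for g
  define c where "c = f (\<one>, None)"
  define I where "I = {f (a, Some e) | a e. e \<in> E \<and> a \<in> {\<one>, e}}"
  have l: "l g (f (h, s)) = f (g \<otimes> h, s)" if "(h, s) \<in> X" for g h s
    unfolding l_def using that f by simp
  have \<phi>: "\<phi> g (f (h, s)) = f (g \<otimes> h, s)" if "(h, s) \<in> X" for g h s
    unfolding \<phi>_def A_def using that l by simp
  have X: "(h, None) \<in> X" "e \<in> E \<Longrightarrow> (h, Some e) \<in> X" if "h \<in> carrier G" for h e
    using that unfolding X_def by auto
  have feq: "f x = f y \<longleftrightarrow> x = y" if "x \<in> X" "y \<in> X" for x y
    using f that by (auto dest: inj_onD)
  have pg: "pointed_gset G A \<phi> c"
    unfolding \<phi>_def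
  proof (rule pointed_gset_restrictI[OF is_group])
    show "c \<in> A" unfolding c_def A_def using X by blast
    show "l g x \<in> A" if "g \<in> carrier G" "x \<in> A" for g x
      using that l unfolding A_def X_def by auto
    show "l \<one> x = x" if "x \<in> A" for x
      using that l unfolding A_def X_def by auto
    show "l g (l h x) = l (g \<otimes> h) x" if "g \<in> carrier G" "h \<in> carrier G" "x \<in> A" for g h x
      using that l unfolding A_def X_def by (auto simp: m_assoc)
  qed
  have orb: "\<phi> g c = f (g, None)" if "g \<in> carrier G" for g
    unfolding c_def using \<phi>[OF X(1)[OF one_closed]] that by simp
  have IA: "I \<subseteq> A" unfolding I_def A_def using X(2) E(1) by auto
  have inj: "inj_on (\<lambda>g. \<phi> g c) (carrier G)"
    by (rule inj_onI) (simp add: orb feq X)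
  have disj: "\<phi> g c \<notin> I" if g: "g \<in> carrier G" for g
  proof
    assume "\<phi> g c \<in> I"
    then obtain a e where "f (g, None) = f (a, Some e)" "e \<in> E" "a \<in> carrier G"
      unfolding orb[OF g] I_def using E(1) by auto
    then show False using feq X g by simp
  qed
  have mem: "f (a, Some e) \<in> I \<longleftrightarrow> a = \<one> \<or> a = e" if "a \<in> carrier G" "e \<in> E" for a e
  proof
    assume "f (a, Some e) \<in> I"
    then obtain b d where "f (a, Some e) = f (b, Some d)" "d \<in> E" "b \<in> {\<one>, d}"
      unfolding I_def by blast
    then show "a = \<one> \<or> a = e" using feq X that E(1) by auto
  qed (use that in \<open>auto simp: I_def\<close>)
  have ret: "returners \<phi> I = E"
  proof (intro equalityI subsetI)
    fix g assume "g \<in> returners \<phi> I"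
    then obtain a e where g: "g \<in> carrier G" and e: "e \<in> E" "a \<in> {\<one>, e}"
      and "\<phi> g (f (a, Some e)) \<in> I"
      unfolding returners_def I_def by blast
    moreover have carr: "a \<in> carrier G" "e \<in> carrier G" using e E(1) by auto
    ultimately have "f (g \<otimes> a, Some e) \<in> I" using \<phi>[OF X(2)] by simp
    then have "g \<otimes> a = \<one> \<or> g \<otimes> a = e" using mem[OF _ e(1)] g carr by simp
    then consider "g = \<one>" | "g = e" | "g = inv e"
      using e(2) g carr by (auto simp: inv_equality[symmetric])
    then show "g \<in> E"
    proof cases
      case 3
      then have "g \<in> set_inv E" using e(1) by (auto simp: mem_set_inv)
      then show ?thesis by (simp add: E(3)[symmetric])
    qed (use e E(2) in auto)
  next
    fix g assume g: "g \<in> E"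
    then have "g \<in> carrier G" using E(1) by blast
    then have "\<phi> g (f (\<one>, Some g)) = f (g, Some g)" using \<phi>[OF X(2)[OF one_closed g]] by simp
    then show "g \<in> returners \<phi> I"
      using mem[OF one_closed g] mem[OF \<open>g \<in> carrier G\<close> g] \<open>g \<in> carrier G\<close>
      unfolding returners_def by force
  qed
  show ?thesis by (rule that[OF pg IA inj disj ret])
qed

text \<open>Since the orbit is free, different sets in the group give different subsets of the algebra; so a
bound on the number of deductive steps bounds the recursion on the group.\<close>

lemma quotient_step_stationary_if_rank_bound:
  assumes fin: "finite (carrier G)" and inf: "infinite (UNIV :: 'x set)"
    and stab: "\<And>(A :: 'x set) \<phi> c I. pointed_gset G A \<phi> c \<Longrightarrow> I \<subseteq> A \<Longrightarrow> I \<noteq> {} \<Longrightarrow>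
      (deductive_op G A \<phi> c ^^ n) I = (deductive_op G A \<phi> c ^^ Suc n) I"
    and F: "F \<subseteq> carrier G" and E: "E \<subseteq> carrier G" "\<one> \<in> E" "E = set_inv E"
  shows "(quotient_step E ^^ n) F = (quotient_step E ^^ Suc n) F"
proof -
  obtain A :: "'x set" and \<phi> c I where pg: "pointed_gset G A \<phi> c" and I: "I \<subseteq> A"
    and free: "inj_on (\<lambda>g. \<phi> g c) (carrier G)"
    and disj: "\<And>g. g \<in> carrier G \<Longrightarrow> \<phi> g c \<notin> I" and ret: "returners \<phi> I = E"
    by (rule ex_free_pointed_gset[OF fin inf E]) (rule that)
  note ids = pointed_gset_identities[OF pg]
  let ?J = "I \<union> (\<lambda>g. \<phi> g c) ` F"
  let ?Q = "\<lambda>n. (quotient_step E ^^ n) F"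
  note iter = deductive_op_iterate_free_orbit[OF pg I F free disj, unfolded ret]
  have "I \<noteq> {}" using E(2) ret unfolding returners_def by blast
  moreover have "?J \<subseteq> A" using I F ids(1,2) by blast
  ultimately have "(deductive_op G A \<phi> c ^^ n) ?J = (deductive_op G A \<phi> c ^^ Suc n) ?J"
    by (intro stab[OF pg]) auto
  then have eq: "I \<union> (\<lambda>g. \<phi> g c) ` ?Q n = I \<union> (\<lambda>g. \<phi> g c) ` ?Q (Suc n)"
    using iter[of n] iter[of "Suc n"] by metis
  have "?Q m \<subseteq> carrier G" for m using iter[of m] by (rule conjunct2)
  then have disjQ: "(\<lambda>g. \<phi> g c) ` ?Q m \<inter> I = {}" for m using disj by blast
  have "(\<lambda>g. \<phi> g c) ` ?Q n = (\<lambda>g. \<phi> g c) ` ?Q (Suc n)"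
    using eq disjQ[of n] disjQ[of "Suc n"] by blast
  then show ?thesis
    using inj_on_image_eq_iff[OF free] \<open>\<And>m. ?Q m \<subseteq> carrier G\<close> by blast
qed

end

section \<open>The rank and the diameter bounds\<close>

context group
begin

lemma deductive_rank_eqI:
  assumes "\<And>n. (\<forall>(A :: 'x set) \<phi> c I. pointed_gset G A \<phi> c \<and> I \<subseteq> A \<and> I \<noteq> {} \<longrightarrow>
      (deductive_op G A \<phi> c ^^ n) I = (deductive_op G A \<phi> c ^^ Suc n) I) \<longleftrightarrow> r \<le> n"
  shows "deductive_rank G TYPE('x) = enat r"
  unfolding deductive_rank_def assms
  by (rule antisym) (auto intro: Inf_lower Inf_greatest)

text \<open>The possible sets reached after one step of the recursion.\<close>

definition initial_stages :: "'a set set" where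
  "initial_stages = {quotient_step E F | E F.
    F \<subseteq> carrier G \<and> E \<subseteq> carrier G \<and> \<one> \<in> E \<and> E = set_inv E}"

text \<open>For \<open>B\<close> not a subgroup, the step at which the recursion through \<open>B\<close> becomes stationary.\<close>

definition stage_bound :: "'a set \<Rightarrow> int" where
  "stage_bound B = 2 + \<lceil>log 2 (real (diam G (generate G B) (B <#> set_inv B)))\<rceil>"

lemma mem_initial_stages:
  "B \<in> initial_stages \<longleftrightarrow> (\<exists>F E. F \<subseteq> carrier G \<and> E \<subseteq> carrier G \<and> \<one> \<in> E \<and> E = set_inv E \<and>
     B = F \<union> (F <#> set_inv F) \<union> E)"
  unfolding initial_stages_def quotient_step_def mem_Collect_eq
  by (intro iffI; elim exE conjE; intro exI conjI)

lemma initial_stage_closed: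
  assumes "B \<in> initial_stages"
  shows "B \<subseteq> carrier G" "\<one> \<in> B"
proof -
  obtain E F where "F \<subseteq> carrier G" "E \<subseteq> carrier G" "\<one> \<in> E" "B = quotient_step E F"
    using assms unfolding initial_stages_def by blast
  then show "B \<subseteq> carrier G" "\<one> \<in> B"
    using quotient_step_closed[of E F] by (simp_all add: quotient_step_def)
qed

text \<open>The condition \<open>1 \<le> n\<close> is not implied by the others, since it may happen that every initial stage is a
subgroup.  It comes from the pair \<open>F = {}\<close>, \<open>E = {1}\<close>: there \<open>c\<close> is missing at first and is deduced
at once.\<close>

lemma iterates_stable_iff:
  assumes fin: "finite (carrier G)" and inf: "infinite (UNIV :: 'x set)"
  shows "(\<forall>(A :: 'x set) \<phi> c I. pointed_gset G A \<phi> c \<and> I \<subseteq> A \<and> I \<noteq> {} \<longrightarrow>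
      (deductive_op G A \<phi> c ^^ n) I = (deductive_op G A \<phi> c ^^ Suc n) I) \<longleftrightarrow>
    1 \<le> n \<and> (\<forall>B\<in>initial_stages. \<not> subgroup B G \<longrightarrow> stage_bound B \<le> int n)"
proof (intro iffI conjI ballI impI allI)
  assume stab: "\<forall>(A :: 'x set) \<phi> c I. pointed_gset G A \<phi> c \<and> I \<subseteq> A \<and> I \<noteq> {} \<longrightarrow>
      (deductive_op G A \<phi> c ^^ n) I = (deductive_op G A \<phi> c ^^ Suc n) I"
  have stationary: "(quotient_step E ^^ n) F = (quotient_step E ^^ Suc n) F"
    if "F \<subseteq> carrier G" "E \<subseteq> carrier G" "\<one> \<in> E" "E = set_inv E" for E F
    by (rule quotient_step_stationary_if_rank_bound[OF fin inf _ that]) (use stab in blast)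
  show n: "1 \<le> n"
  proof (rule ccontr)
    assume "\<not> 1 \<le> n"
    then have "n = 0" by simp
    have "(quotient_step {\<one>} ^^ n) {} = (quotient_step {\<one>} ^^ Suc n) {}"
      by (rule stationary) (auto simp: SET_INV_def)
    then show False unfolding \<open>n = 0\<close> by (simp add: quotient_step_def)
  qed
  fix B assume "B \<in> initial_stages" and nsub: "\<not> subgroup B G"
  then obtain E F where F: "F \<subseteq> carrier G" and E: "E \<subseteq> carrier G" "\<one> \<in> E" "E = set_inv E"
    and B: "B = quotient_step E F"
    unfolding initial_stages_def by blast
  have "(quotient_step E ^^ n) F = (quotient_step E ^^ Suc n) F"
    by (rule stationary[OF F E])
  then have "(quotient_step E ^^ n) F = generate G B"
    unfolding B by (rule quotient_step_stationary[OF F E(1,2)])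
  then show "stage_bound B \<le> int n"
    using quotient_step_iterate_eq_generate_iff[OF F E(1,2) fin B n] nsub
    unfolding stage_bound_def by blast
next
  fix A :: "'x set" and \<phi> c I
  assume n: "1 \<le> n \<and> (\<forall>B\<in>initial_stages. \<not> subgroup B G \<longrightarrow> stage_bound B \<le> int n)"
    and I: "pointed_gset G A \<phi> c \<and> I \<subseteq> A \<and> I \<noteq> {}"
  show "(deductive_op G A \<phi> c ^^ n) I = (deductive_op G A \<phi> c ^^ Suc n) I"
  proof (rule deductive_op_stable[OF _ _ _ fin])
    fix F E assume FE: "F \<subseteq> carrier G" "E \<subseteq> carrier G" "\<one> \<in> E" "E = set_inv E"
    then have "quotient_step E F \<in> initial_stages" unfolding initial_stages_def by blast
    then show "(quotient_step E ^^ n) F = generate G (quotient_step E F)"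
      using quotient_step_iterate_eq_generate_iff[OF FE(1-3) fin refl, of n] n
      unfolding stage_bound_def by blast
  qed (use I n in auto)
qed

lemma finite_stage_bounds:
  assumes "finite (carrier G)"
  shows "finite {stage_bound B | B. B \<in> initial_stages \<and> \<not> subgroup B G}"
proof (rule finite_subset)
  show "{stage_bound B | B. B \<in> initial_stages \<and> \<not> subgroup B G} \<subseteq> stage_bound ` Pow (carrier G)"
    using initial_stage_closed(1) by blast
qed (use assms in simp)

lemma deductive_rank_eq:
  assumes fin: "finite (carrier G)" and inf: "infinite (UNIV :: 'x set)"
  shows "deductive_rank G TYPE('x) =
    enat (nat (Max (insert 1 {stage_bound B | B. B \<in> initial_stages \<and> \<not> subgroup B G})))"
proof (rule deductive_rank_eqI)
  fix n
  let ?M = "{stage_bound B | B. B \<in> initial_stages \<and> \<not> subgroup B G}"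
  have "nat (Max (insert 1 ?M)) \<le> n \<longleftrightarrow> (\<forall>m\<in>insert 1 ?M. m \<le> int n)"
    using finite_stage_bounds[OF fin] by (subst nat_le_iff, subst Max_le_iff) auto
  also have "\<dots> \<longleftrightarrow>
    1 \<le> n \<and> (\<forall>B\<in>initial_stages. \<not> subgroup B G \<longrightarrow> stage_bound B \<le> int n)"
    by auto
  finally show "(\<forall>(A :: 'x set) \<phi> c I. pointed_gset G A \<phi> c \<and> I \<subseteq> A \<and> I \<noteq> {} \<longrightarrow>
      (deductive_op G A \<phi> c ^^ n) I = (deductive_op G A \<phi> c ^^ Suc n) I) \<longleftrightarrow>
    nat (Max (insert 1 ?M)) \<le> n"
    unfolding iterates_stable_iff[OF fin inf] by (rule sym)
qed

abbreviation symmetric_diams :: "nat set" where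
  "symmetric_diams \<equiv> {diam G H S | H S. subgroup H G \<and> S \<subseteq> carrier G \<and> \<one> \<in> S \<and>
    S = set_inv S \<and> generate G S = H}"

lemma finite_symmetric_diams:
  assumes "finite (carrier G)"
  shows "finite symmetric_diams"
proof (rule finite_subset)
  show "symmetric_diams \<subseteq> (\<lambda>S. diam G (generate G S) S) ` Pow (carrier G)" by blast
qed (use assms in simp)

lemma symmetric_diamsI:
  assumes "S \<subseteq> carrier G" "\<one> \<in> S" "S = set_inv S"
  shows "diam G (generate G S) S \<in> symmetric_diams"
  by (rule CollectI, rule exI[of _ "generate G S"], rule exI[of _ S])
    (intro conjI refl generate_is_subgroup assms)

lemma diam_le_Delta_sub:
  assumes "finite (carrier G)" "S \<subseteq> carrier G" "\<one> \<in> S" "S = set_inv S"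
  shows "diam G (generate G S) S \<le> Delta_sub G"
  unfolding Delta_sub_def
  by (rule Max_ge[OF finite_symmetric_diams[OF assms(1)] symmetric_diamsI[OF assms(2-4)]])

lemma Delta_sub_attained:
  assumes "finite (carrier G)"
  obtains S where "S \<subseteq> carrier G" "\<one> \<in> S" "S = set_inv S"
    "Delta_sub G = diam G (generate G S) S"
proof -
  have "diam G (generate G (carrier G)) (carrier G) \<in> symmetric_diams"
    by (rule symmetric_diamsI) (simp_all add: set_inv_subgroup[OF subgroup_self])
  then have "symmetric_diams \<noteq> {}" by (metis empty_iff)
  then have "Delta_sub G \<in> symmetric_diams"
    unfolding Delta_sub_def by (rule Max_in[OF finite_symmetric_diams[OF assms]])
  then show ?thesis by (elim CollectE exE conjE) (rule that, assumption+, hypsubst, assumption)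
qed

lemma Delta_sub_pos:
  assumes "finite (carrier G)" "carrier G \<noteq> {\<one>}"
  shows "1 \<le> Delta_sub G"
proof -
  have inv: "carrier G = set_inv (carrier G)" by (rule set_inv_subgroup[OF subgroup_self, symmetric])
  have gen: "generate G (carrier G) = carrier G" by (rule generate_subgroup_eq[OF subgroup_self])
  have "\<not> diam G (carrier G) (carrier G) \<le> 0"
    using set_power_eq_generate_iff[OF order_refl one_closed inv assms(1), of 0] assms(2) gen by auto
  then show ?thesis
    using diam_le_Delta_sub[OF assms(1) order_refl one_closed inv] gen by simp
qed

text \<open>\<open>B B\<inverse>\<close> is a symmetric generating set of \<open>\<langle>B\<rangle>\<close> containing \<open>1\<close>, so its diameter enters \<open>\<Delta>\<^sub>s\<^sub>u\<^sub>b\<close>.\<close>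

lemma stage_bound_le:
  assumes fin: "finite (carrier G)" and B: "B \<in> initial_stages" and nsub: "\<not> subgroup B G"
  shows "stage_bound B \<le> 2 + \<lceil>log 2 (real (Delta_sub G))\<rceil>"
proof -
  note Bc = initial_stage_closed[OF B]
  have "\<one> \<in> B <#> set_inv B" using subset_quotient_set[OF Bc] Bc(2) by blast
  then have "diam G (generate G B) (B <#> set_inv B) \<le> Delta_sub G"
    using diam_le_Delta_sub[OF fin quotient_set_closed[OF Bc(1)] _ quotient_set_symmetric[OF Bc(1)]]
    by (simp add: generate_quotient_set[OF Bc])
  then show ?thesis
    using diam_quotient_set_pos[OF Bc fin nsub] unfolding stage_bound_def
    by (intro add_left_mono ceiling_mono) simp
qed

text \<open>Let \<open>S\<close> have the maximal diameter \<open>\<Delta>\<close>, and take \<open>F = {}\<close> and \<open>E = S\<close>, so that \<open>B = S\<close>.  If \<open>(S S)\<^sup>d\<close> is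
the whole group, then so is \<open>S\<^sup>2\<^sup>d\<close>, whence \<open>\<Delta> \<le> 2 d\<close>.  If \<open>\<Delta> \<ge> 2\<close>, then \<open>S\<close> is not a
subgroup.\<close>

lemma ex_stage_bound_ge:
  assumes fin: "finite (carrier G)" and Delta: "2 \<le> Delta_sub G"
  obtains B where "B \<in> initial_stages" "\<not> subgroup B G"
    "1 + \<lceil>log 2 (real (Delta_sub G))\<rceil> \<le> stage_bound B"
proof -
  obtain S where S: "S \<subseteq> carrier G" "\<one> \<in> S" "S = set_inv S"
    and D: "Delta_sub G = diam G (generate G S) S"
    by (rule Delta_sub_attained[OF fin])
  note iff = set_power_eq_generate_iff[OF S fin, folded D]
  have nsub: "\<not> subgroup S G"
  proof
    assume "subgroup S G"
    then have "set_power G S 1 = generate G S"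
      using generate_subgroup_eq S(1) by (simp add: one_set_mult)
    then show False using iff[of 1] Delta by simp
  qed
  have "quotient_step S {} = S" unfolding quotient_step_def set_mult_def by simp
  then have stage: "S \<in> initial_stages" using S unfolding initial_stages_def by blast
  define d where "d = diam G (generate G S) (S <#> set_inv S)"
  have "set_power G (S <#> S) d = generate G S"
    using set_power_quotient_set_iff[OF S(1,2) fin, of d] unfolding d_def S(3)[symmetric] by simp
  then have le: "Delta_sub G \<le> 2 * d"
    unfolding set_power_double[OF S(1)] iff .
  have d: "1 \<le> d" unfolding d_def by (rule diam_quotient_set_pos[OF S(1,2) fin nsub])
  have "log 2 (real (Delta_sub G)) \<le> log 2 (2 * real d)"
    using le Delta by simp
  also have "\<dots> = 1 + log 2 (real d)" using d by (simp add: log_mult)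
  finally have "\<lceil>log 2 (real (Delta_sub G))\<rceil> \<le> 1 + \<lceil>log 2 (real d)\<rceil>" by linarith
  then show ?thesis
    using that[OF stage nsub] unfolding stage_bound_def d_def by linarith
qed

end

theorem theorem4p6:
  fixes G :: "('g, 'm) monoid_scheme"
  assumes "group G" and "finite (carrier G)" and "carrier G \<noteq> {\<one>\<^bsub>G\<^esub>}"
    and "infinite (UNIV :: 'a set)"
  shows "\<exists>r::nat. deductive_rank G TYPE('a) = enat r \<and>
    1 + \<lceil>log 2 (real (Delta_sub G))\<rceil> \<le> int r \<and>
    int r \<le> 2 + \<lceil>log 2 (real (Delta_sub G))\<rceil> \<and>
    int r = Max (insert 1
      {2 + \<lceil>log 2 (real (diam G (generate G B) (B <#>\<^bsub>G\<^esub> set_inv\<^bsub>G\<^esub> B)))\<rceil> | B.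
        (\<exists>F E. F \<subseteq> carrier G \<and> E \<subseteq> carrier G \<and> \<one>\<^bsub>G\<^esub> \<in> E \<and> E = set_inv\<^bsub>G\<^esub> E \<and>
           B = F \<union> (F <#>\<^bsub>G\<^esub> set_inv\<^bsub>G\<^esub> F) \<union> E) \<and>
        \<not> subgroup B G})"
proof -
  interpret group G by fact
  define M where "M = {stage_bound B | B. B \<in> initial_stages \<and> \<not> subgroup B G}"
  define r where "r = nat (Max (insert 1 M))"
  have fin: "finite (insert 1 M)" using finite_stage_bounds[OF assms(2)] unfolding M_def by simp
  have rank: "deductive_rank G TYPE('a) = enat r"
    unfolding r_def M_def by (rule deductive_rank_eq[OF assms(2,4)])
  have "1 \<le> Max (insert 1 M)" using fin by simp
  then have r: "int r = Max (insert 1 M)" unfolding r_def by simp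
  have Delta: "1 \<le> Delta_sub G" by (rule Delta_sub_pos[OF assms(2,3)])
  have lower: "1 + \<lceil>log 2 (real (Delta_sub G))\<rceil> \<le> int r"
  proof (cases "Delta_sub G = 1")
    case True
    then show ?thesis using fin unfolding r by simp
  next
    case False
    then obtain B where "B \<in> initial_stages" "\<not> subgroup B G"
      "1 + \<lceil>log 2 (real (Delta_sub G))\<rceil> \<le> stage_bound B"
      using ex_stage_bound_ge[OF assms(2)] Delta by auto
    moreover from this have "stage_bound B \<le> Max (insert 1 M)"
      by (intro Max_ge[OF fin]) (auto simp: M_def)
    ultimately show ?thesis unfolding r by linarith
  qed
  have "0 \<le> log 2 (real (Delta_sub G))" using Delta by simp
  then have "1 \<le> 2 + \<lceil>log 2 (real (Delta_sub G))\<rceil>" by linarith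
  then have upper: "int r \<le> 2 + \<lceil>log 2 (real (Delta_sub G))\<rceil>"
    unfolding r using fin stage_bound_le[OF assms(2)] by (auto simp: M_def)
  show ?thesis
    using rank lower upper r unfolding M_def mem_initial_stages stage_bound_def by blast
qed

end
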